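(* Let $X,Y$ be topological spaces and let $H_*(-)$ be homology with coefficients in a ring $\mathscr{R}$. Then the following maps are well-defined and monotone (order-preserving): (1) $\operatorname{Im}_{H_*}:([X,Y],\leqq_R)\to(\mathcal{S}ub(H_*(Y)),\leqq)$, $\operatorname{Im}_{H_*}([f]):=\operatorname{Im}(f_*:H_*(X)\to H_*(Y))$; (2) $\operatorname{Im}'_{H_*}:([X,Y]_R,\leqq'_R)\to(\mathcal{S}ub(H_*(Y)),\leqq)$, $\operatorname{Im}'_{H_*}([f]_R):=\operatorname{Im}_{H_*}([f])$. Moreover $\operatorname{Im}'_{H_*}\circ\pi_R=\operatorname{Im}_{H_*}$, where $\pi_R:[X,Y]\to[X,Y]_R$ is the quotient map $[f]\mapsto[f]_R$.
   Context: $[X,Y]$ is the set of homotopy classes of continuous maps $X\to Y$. The preorder $\leqq_R$ on $[X,Y]$: $[f]\leqq_R[g]$ iff there is $[s]\in[X,X]$ with $[f]=[g]\circ[s]$. The equivalence relation $\sim_R$: $[f]\sim_R[g]$ iff $[f]\leqq_R[g]$ and $[g]\leqq_R[f]$; $[X,Y]_R=[X,Y]/\sim_R$, with the class of $[f]$ denoted $[f]_R$, partially ordered by $[f]_R\leqq'_R[g]_R$ iff $[f]\leqq_R[g]$. For a group $G$, $\mathcal{S}ub(G)$ is the set of all subgroups of $G$, partially ordered by inclusion ($A\leqq B$ iff $A\subseteq B$). *)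

theory Defs
  imports "HOL-Homology.Homology"
begin

section \<open>Singular homology with coefficients in a ring\<close>

text \<open>
  The library only treats integral homology.  We reuse its singular simplices, faces and
  \<^const>\<open>simplex_map\<close>, and let chains be the finitely supported functions from simplices to the
  coefficient ring, i.e. formal finite \<open>'r\<close>-linear combinations of simplices.  The class \<^class>\<open>ring\<close>
  covers unital and non-unital, commutative and non-commutative rings, and the zero ring.
\<close>

type_synonym ('a, 'r) rchain = "((nat \<Rightarrow> real) \<Rightarrow> 'a) \<Rightarrow>\<^sub>0 'r"

definition rchain_group :: "nat \<Rightarrow> 'a topology \<Rightarrow> ('a, 'r::ring) rchain monoid"
  where "rchain_group p X =
    \<lparr>carrier = {c. Poly_Mapping.keys c \<subseteq> singular_simplex_set p X}, monoid.mult = (+), one = 0\<rparr>"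

text \<open>The sign \<open>(-1)\<^sup>k\<close> is written as a case distinction since the ring need not contain a unit.\<close>

definition rchain_boundary :: "nat \<Rightarrow> ('a, 'r::ring) rchain \<Rightarrow> ('a, 'r) rchain"
  where "rchain_boundary p c =
    (if p = 0 then 0 else
       \<Sum>\<sigma>\<in>Poly_Mapping.keys c. \<Sum>k\<le>p.
         Poly_Mapping.single (singular_face p k \<sigma>)
           (if even k then Poly_Mapping.lookup c \<sigma> else - Poly_Mapping.lookup c \<sigma>))"

definition rchain_map :: "nat \<Rightarrow> ('a \<Rightarrow> 'b) \<Rightarrow> ('a, 'r::ring) rchain \<Rightarrow> ('b, 'r) rchain"
  where "rchain_map p f c =
    (\<Sum>\<sigma>\<in>Poly_Mapping.keys c. Poly_Mapping.single (simplex_map p f \<sigma>) (Poly_Mapping.lookup c \<sigma>))"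

definition rcycle_group :: "nat \<Rightarrow> 'a topology \<Rightarrow> ('a, 'r::ring) rchain monoid"
  where "rcycle_group p X =
    (rchain_group p X)\<lparr>carrier := {c \<in> carrier (rchain_group p X). rchain_boundary p c = 0}\<rparr>"

definition rboundary_set :: "nat \<Rightarrow> 'a topology \<Rightarrow> ('a, 'r::ring) rchain set"
  where "rboundary_set p X = rchain_boundary (Suc p) ` carrier (rchain_group (Suc p) X)"

definition rhomology_group :: "nat \<Rightarrow> 'a topology \<Rightarrow> ('a, 'r::ring) rchain set monoid"
  where "rhomology_group p X = rcycle_group p X Mod rboundary_set p X"

text \<open>
  Maps on quotients are written \<open>the_elem (h ` C)\<close>: the common value of \<open>h\<close> on the
  representatives in \<open>C\<close>, which is meaningful only if that value does not depend on
  the representative.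
\<close>

definition rhomology_map ::
    "nat \<Rightarrow> 'b topology \<Rightarrow> ('a \<Rightarrow> 'b) \<Rightarrow> ('a, 'r::ring) rchain set \<Rightarrow> ('b, 'r) rchain set"
  where "rhomology_map p Y f C =
    the_elem ((\<lambda>c. rboundary_set p Y #>\<^bsub>rcycle_group p Y\<^esub> rchain_map p f c) ` C)"

text \<open>
  \<open>H\<^sub>*\<close> is the direct sum of the homology groups in all degrees (those in negative degrees are
  trivial), so that it is a single group; the argument of type \<open>'r itself\<close> names the
  coefficient ring.
\<close>

definition total_homology ::
    "'r::ring itself \<Rightarrow> 'a topology \<Rightarrow> (nat \<Rightarrow> ('a, 'r) rchain set) monoid"
  where "total_homology R X = sum_group UNIV (\<lambda>p. rhomology_group p X)"

definition total_homology_map ::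
    "'b topology \<Rightarrow> ('a \<Rightarrow> 'b) \<Rightarrow> (nat \<Rightarrow> ('a, 'r::ring) rchain set) \<Rightarrow> (nat \<Rightarrow> ('b, 'r) rchain set)"
  where "total_homology_map Y f z = (\<lambda>p. rhomology_map p Y f (z p))"

definition homology_image ::
    "'r::ring itself \<Rightarrow> 'a topology \<Rightarrow> 'b topology \<Rightarrow> ('a \<Rightarrow> 'b) \<Rightarrow> (nat \<Rightarrow> ('b, 'r) rchain set) set"
  where "homology_image R X Y f = total_homology_map Y f ` carrier (total_homology R X)"


section \<open>Homotopy classes and the preorder by precomposition\<close>

text \<open>
  Functions are total on the underlying types, but \<^const>\<open>homotopic_with\<close> identifies maps that
  agree on \<^term>\<open>topspace X\<close>, so values outside the space do not affect the quotient.
\<close>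

definition homotopy_rel :: "'a topology \<Rightarrow> 'b topology \<Rightarrow> (('a \<Rightarrow> 'b) \<times> ('a \<Rightarrow> 'b)) set"
  where "homotopy_rel X Y = {(f, g). homotopic_with (\<lambda>_. True) X Y f g}"

definition homotopy_class :: "'a topology \<Rightarrow> 'b topology \<Rightarrow> ('a \<Rightarrow> 'b) \<Rightarrow> ('a \<Rightarrow> 'b) set"
  where "homotopy_class X Y f = homotopy_rel X Y `` {f}"

definition homotopy_classes :: "'a topology \<Rightarrow> 'b topology \<Rightarrow> ('a \<Rightarrow> 'b) set set"
  where "homotopy_classes X Y = {f. continuous_map X Y f} // homotopy_rel X Y"

definition class_comp ::
    "'a topology \<Rightarrow> 'c topology \<Rightarrow> ('b \<Rightarrow> 'c) set \<Rightarrow> ('a \<Rightarrow> 'b) set \<Rightarrow> ('a \<Rightarrow> 'c) set"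
  where "class_comp X Z G S = the_elem ((\<lambda>(g, s). homotopy_class X Z (g \<circ> s)) ` (G \<times> S))"

definition leR :: "'a topology \<Rightarrow> 'b topology \<Rightarrow> ('a \<Rightarrow> 'b) set \<Rightarrow> ('a \<Rightarrow> 'b) set \<Rightarrow> bool"
  where "leR X Y F G \<longleftrightarrow> (\<exists>S \<in> homotopy_classes X X. F = class_comp X Y G S)"

definition simR :: "'a topology \<Rightarrow> 'b topology \<Rightarrow> (('a \<Rightarrow> 'b) set \<times> ('a \<Rightarrow> 'b) set) set"
  where "simR X Y =
    {(F, G). F \<in> homotopy_classes X Y \<and> G \<in> homotopy_classes X Y \<and> leR X Y F G \<and> leR X Y G F}"

definition R_classes :: "'a topology \<Rightarrow> 'b topology \<Rightarrow> ('a \<Rightarrow> 'b) set set set"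
  where "R_classes X Y = homotopy_classes X Y // simR X Y"

definition piR :: "'a topology \<Rightarrow> 'b topology \<Rightarrow> ('a \<Rightarrow> 'b) set \<Rightarrow> ('a \<Rightarrow> 'b) set set"
  where "piR X Y F = simR X Y `` {F}"

definition leR' :: "'a topology \<Rightarrow> 'b topology \<Rightarrow> ('a \<Rightarrow> 'b) set set \<Rightarrow> ('a \<Rightarrow> 'b) set set \<Rightarrow> bool"
  where "leR' X Y A B \<longleftrightarrow> (\<exists>F \<in> A. \<exists>G \<in> B. leR X Y F G)"

text \<open>The definitions do what they should on representatives.\<close>

lemma equiv_homotopy_rel: "equiv {f. continuous_map X Y f} (homotopy_rel X Y)"
  unfolding homotopy_rel_def
  by (rule equivI)
     (auto simp: refl_on_def dest: homotopic_with_imp_continuous_maps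
           intro!: symI transI intro: homotopic_with_symD homotopic_with_trans)

lemma homotopy_class_eq_iff:
  assumes "continuous_map X Y f" "continuous_map X Y g"
  shows "homotopy_class X Y f = homotopy_class X Y g \<longleftrightarrow> homotopic_with (\<lambda>_. True) X Y f g"
  using eq_equiv_class_iff [OF equiv_homotopy_rel, of f X Y g] assms
  by (simp add: homotopy_class_def) (simp add: homotopy_rel_def)

lemma homotopy_classesE:
  assumes "F \<in> homotopy_classes X Y"
  obtains f where "continuous_map X Y f" "F = homotopy_class X Y f"
  using assms by (auto simp: homotopy_classes_def homotopy_class_def quotient_def)

lemma homotopy_class_in: "continuous_map X Y f \<Longrightarrow> homotopy_class X Y f \<in> homotopy_classes X Y"
  by (auto simp: homotopy_classes_def homotopy_class_def quotient_def)

lemma class_comp_homotopy_class: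
  assumes g: "continuous_map Y Z g" and s: "continuous_map X Y s"
  shows "class_comp X Z (homotopy_class Y Z g) (homotopy_class X Y s) = homotopy_class X Z (g \<circ> s)"
proof -
  have "homotopy_class X Z (g' \<circ> s') = homotopy_class X Z (g \<circ> s)"
    if "homotopic_with (\<lambda>_. True) Y Z g g'" "homotopic_with (\<lambda>_. True) X Y s s'" for g' s'
  proof -
    have s': "continuous_map X Y s'"
      using that(2) homotopic_with_imp_continuous_maps by blast
    have "homotopic_with (\<lambda>_. True) X Z (g \<circ> s) (g \<circ> s')"
      by (rule homotopic_with_compose_continuous_map_left [OF that(2) g]) simp
    moreover have "homotopic_with (\<lambda>_. True) X Z (g \<circ> s') (g' \<circ> s')"
      by (rule homotopic_with_compose_continuous_map_right [OF that(1) s']) simp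
    ultimately have gs: "homotopic_with (\<lambda>_. True) X Z (g \<circ> s) (g' \<circ> s')"
      by (rule homotopic_with_trans)
    show ?thesis
      using gs homotopy_class_eq_iff homotopic_with_imp_continuous_maps [OF gs] by metis
  qed
  then have "(\<lambda>(g, s). homotopy_class X Z (g \<circ> s)) p = homotopy_class X Z (g \<circ> s)"
    if "p \<in> homotopy_class Y Z g \<times> homotopy_class X Y s" for p
    using that by (cases p) (simp add: homotopy_class_def homotopy_rel_def)
  moreover have "(g, s) \<in> homotopy_class Y Z g \<times> homotopy_class X Y s"
    using g s by (simp add: homotopy_class_def homotopy_rel_def)
  ultimately have "(\<lambda>(g, s). homotopy_class X Z (g \<circ> s)) ` (homotopy_class Y Z g \<times> homotopy_class X Y s)
      = {homotopy_class X Z (g \<circ> s)}"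
    by (metis (no_types, lifting) image_constant_conv image_cong empty_iff)
  then show ?thesis
    by (simp add: class_comp_def)
qed

lemma leR_homotopy_class:
  assumes "continuous_map X Y f" "continuous_map X Y g"
  shows "leR X Y (homotopy_class X Y f) (homotopy_class X Y g) \<longleftrightarrow>
         (\<exists>s. continuous_map X X s \<and> homotopic_with (\<lambda>_. True) X Y f (g \<circ> s))"
proof
  assume "leR X Y (homotopy_class X Y f) (homotopy_class X Y g)"
  then obtain S where "S \<in> homotopy_classes X X"
    and eq: "homotopy_class X Y f = class_comp X Y (homotopy_class X Y g) S"
    by (auto simp: leR_def)
  then obtain s where s: "continuous_map X X s" "S = homotopy_class X X s"
    by (meson homotopy_classesE)
  then have "homotopy_class X Y f = homotopy_class X Y (g \<circ> s)"
    using eq assms by (simp add: class_comp_homotopy_class)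
  then show "\<exists>s. continuous_map X X s \<and> homotopic_with (\<lambda>_. True) X Y f (g \<circ> s)"
    using s(1) homotopy_class_eq_iff [OF assms(1) continuous_map_compose [OF s(1) assms(2)]] by blast
next
  assume "\<exists>s. continuous_map X X s \<and> homotopic_with (\<lambda>_. True) X Y f (g \<circ> s)"
  then obtain s where s: "continuous_map X X s" "homotopic_with (\<lambda>_. True) X Y f (g \<circ> s)"
    by blast
  then have "homotopy_class X Y f = class_comp X Y (homotopy_class X Y g) (homotopy_class X X s)"
    using class_comp_homotopy_class [OF assms(2) s(1)]
      homotopy_class_eq_iff [OF assms(1) continuous_map_compose [OF s(1) assms(2)]] by simp
  then show "leR X Y (homotopy_class X Y f) (homotopy_class X Y g)"
    using homotopy_class_in [OF s(1)] unfolding leR_def by blast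
qed

lemma leR_refl: "F \<in> homotopy_classes X Y \<Longrightarrow> leR X Y F F"
  by (metis comp_id continuous_map_id homotopic_with_refl homotopy_classesE leR_homotopy_class)

lemma leR_trans:
  assumes "leR X Y F G" "leR X Y G K"
    and "F \<in> homotopy_classes X Y" "G \<in> homotopy_classes X Y" "K \<in> homotopy_classes X Y"
  shows "leR X Y F K"
proof -
  obtain f g k where f: "continuous_map X Y f" "F = homotopy_class X Y f"
    and g: "continuous_map X Y g" "G = homotopy_class X Y g"
    and k: "continuous_map X Y k" "K = homotopy_class X Y k"
    using assms by (meson homotopy_classesE)
  obtain s t where s: "continuous_map X X s" "homotopic_with (\<lambda>_. True) X Y f (g \<circ> s)"
    and t: "continuous_map X X t" "homotopic_with (\<lambda>_. True) X Y g (k \<circ> t)"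
    using assms(1,2) f g k by (auto simp: leR_homotopy_class)
  have "homotopic_with (\<lambda>_. True) X Y (g \<circ> s) (k \<circ> t \<circ> s)"
    using homotopic_with_compose_continuous_map_right [OF t(2) s(1)] by simp
  then have "homotopic_with (\<lambda>_. True) X Y f (k \<circ> (t \<circ> s))"
    using homotopic_with_trans [OF s(2)] by (simp add: comp_assoc)
  moreover have "continuous_map X X (t \<circ> s)"
    using s(1) t(1) by (rule continuous_map_compose)
  ultimately show ?thesis
    using f k by (auto simp: leR_homotopy_class)
qed

lemma equiv_simR: "equiv (homotopy_classes X Y) (simR X Y)"
proof (rule equivI)
  show "simR X Y \<subseteq> homotopy_classes X Y \<times> homotopy_classes X Y"
    by (auto simp: simR_def)
  show "refl_on (homotopy_classes X Y) (simR X Y)"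
    by (simp add: refl_on_def simR_def leR_refl)
  show "sym (simR X Y)"
    by (rule symI) (simp add: simR_def)
  show "trans (simR X Y)"
  proof (rule transI)
    fix F G K assume "(F, G) \<in> simR X Y" "(G, K) \<in> simR X Y"
    then show "(F, K) \<in> simR X Y"
      using leR_trans [of X Y F G K] leR_trans [of X Y K G F] by (simp add: simR_def)
  qed
qed

lemma leR'_piR:
  assumes "F \<in> homotopy_classes X Y" "G \<in> homotopy_classes X Y"
  shows "leR' X Y (piR X Y F) (piR X Y G) \<longleftrightarrow> leR X Y F G"
proof
  assume "leR' X Y (piR X Y F) (piR X Y G)"
  then obtain F' G' where "(F, F') \<in> simR X Y" "(G, G') \<in> simR X Y" "leR X Y F' G'"
    by (auto simp: leR'_def piR_def)
  then show "leR X Y F G"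
    using assms leR_trans [of X Y F F' G'] leR_trans [of X Y F G' G] by (simp add: simR_def)
next
  assume "leR X Y F G"
  then show "leR' X Y (piR X Y F) (piR X Y G)"
    using assms equiv_class_self [OF equiv_simR] unfolding leR'_def piR_def by blast
qed


section \<open>The maps to subgroups of homology\<close>

definition Im_H ::
    "'r::ring itself \<Rightarrow> 'a topology \<Rightarrow> 'b topology \<Rightarrow> ('a \<Rightarrow> 'b) set \<Rightarrow> (nat \<Rightarrow> ('b, 'r) rchain set) set"
  where "Im_H R X Y F = the_elem (homology_image R X Y ` F)"

definition Im_H' ::
    "'r::ring itself \<Rightarrow> 'a topology \<Rightarrow> 'b topology \<Rightarrow> ('a \<Rightarrow> 'b) set set \<Rightarrow> (nat \<Rightarrow> ('b, 'r) rchain set) set"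
  where "Im_H' R X Y A = the_elem (Im_H R X Y ` A)"

definition Sub :: "('g, 'm) monoid_scheme \<Rightarrow> 'g set set"
  where "Sub G = {A. subgroup A G}"

end

theory Submission
  imports Defs
begin

text \<open>
  If \<open>[f] = [g] \<circ> [s]\<close>, then \<open>f\<^sub>* = g\<^sub>* \<circ> s\<^sub>*\<close>, so \<open>Im f\<^sub>* \<subseteq> Im g\<^sub>*\<close>.  This gives monotonicity on
  homotopy classes, and since \<open>\<sim>\<^sub>R\<close> is the equivalence relation of the preorder \<open>\<le>\<^sub>R\<close>, equivalent
  classes have the same image; the map on the quotient and its properties follow.  The argument
  rests on three facts about homology with coefficients: \<open>f\<^sub>*\<close> is a homomorphism, it is functorial,
  and it depends only on the homotopy class of \<open>f\<close>.

  The substantial one is homotopy invariance (\<open>rhomology_map_homotopic\<close>).  A homotopy from \<open>f\<close> to \<open>g\<close>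
  yields an integral chain homotopy (\<open>homotopic_imp_integral_chain_homotopy\<close>), obtained from prisms
  chosen naturally in the simplex (\<open>natural_prisms\<close>).  Chains with coefficients in \<open>R\<close> are integral
  chains tensored with \<open>R\<close>, and the boundary and induced maps are the integral ones tensored with the
  identity (\<open>rchain_boundary_eq_tensor_operator\<close>, \<open>rchain_map_eq_tensor_operator\<close>).  Hence
  \<open>\<partial>\<partial> = 0\<close>, naturality of \<open>\<partial>\<close> and the chain homotopy all pass from \<open>\<int>\<close> to \<open>R\<close>.
\<close>

section \<open>A natural prism operator on integral chains\<close>

text \<open>
  The operator is built by the method of acyclic models.  A singular simplex \<open>\<sigma>\<close> of \<open>X\<close> is the image of
  the identity simplex of \<open>\<Delta>\<^sup>p\<close> under \<open>\<sigma>\<close> itself, so a natural operator from \<open>C\<^sub>p(X)\<close> to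
  \<open>C\<^sub>p\<^sub>+\<^sub>1(I \<times> X)\<close> is the same thing as one chain \<open>P\<close> in \<open>I \<times> \<Delta>\<^sup>p\<close>, pushed forward along
  \<open>id \<times> \<sigma>\<close>.  The chains \<open>P\<close> are chosen degree by degree: the required boundary is a cycle, and
  \<open>I \<times> \<Delta>\<^sup>p\<close> is contractible, so a filling exists.
\<close>

abbreviation cylinder :: "'a topology \<Rightarrow> (real \<times> 'a) topology"
  where "cylinder X \<equiv> prod_topology (top_of_set {0..1}) X"

abbreviation simplex_space :: "nat \<Rightarrow> (nat \<Rightarrow> real) topology"
  where "simplex_space p \<equiv> subtopology (powertop_real UNIV) (standard_simplex p)"

abbreviation standard_chain :: "nat \<Rightarrow> (nat \<Rightarrow> real) chain"
  where "standard_chain p \<equiv> frag_of (restrict id (standard_simplex p))"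

abbreviation cylinder_map :: "('a \<Rightarrow> 'b) \<Rightarrow> real \<times> 'a \<Rightarrow> real \<times> 'b"
  where "cylinder_map f \<equiv> (\<lambda>(t, x). (t, f x))"

abbreviation prism_extend ::
    "nat \<Rightarrow> (real \<times> (nat \<Rightarrow> real)) chain \<Rightarrow> 'a chain \<Rightarrow> (real \<times> 'a) chain"
  where "prism_extend p P \<equiv> frag_extend (\<lambda>\<sigma>. chain_map (Suc p) (cylinder_map \<sigma>) P)"

lemma contractible_simplex_space: "contractible_space (simplex_space p)"
proof -
  obtain a where a: "a \<in> standard_simplex p"
    using nonempty_standard_simplex by blast
  define h where "h \<equiv> \<lambda>(t::real, x::nat\<Rightarrow>real). \<lambda>i. (1 - t) * x i + t * a i"
  have "homotopic_with (\<lambda>x. True) (simplex_space p) (simplex_space p) id (\<lambda>x. a)"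
    unfolding homotopic_with_def
  proof (intro exI conjI allI ballI TrueI)
    \<comment> \<open>the straight-line contraction of the simplex to the point \<open>a\<close>\<close>
    have "continuous_map (cylinder (powertop_real UNIV)) (powertop_real UNIV) h"
    proof -
      have "continuous_map (cylinder (powertop_real UNIV)) euclideanreal fst"
        by (rule continuous_map_into_fulltopology [OF continuous_map_fst])
      moreover have "continuous_map (cylinder (powertop_real UNIV)) euclideanreal (\<lambda>z. snd z i)" for i :: nat
        using continuous_map_compose [OF continuous_map_snd continuous_map_product_projection [of i UNIV]]
        by (simp add: o_def)
      ultimately show ?thesis
        unfolding continuous_map_componentwise_UNIV h_def case_prod_unfold
        by (intro allI continuous_map_add continuous_map_real_mult continuous_map_diff) auto
    qed
    then have "continuous_map (cylinder (simplex_space p)) (powertop_real UNIV) h"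
      unfolding prod_topology_subtopology(2) by (rule continuous_map_from_subtopology)
    moreover have "h z \<in> standard_simplex p" if "z \<in> {0..1} \<times> standard_simplex p" for z
      using that a convex_standard_simplex [of "snd z" p a "fst z"] by (auto simp: h_def)
    ultimately show "continuous_map (cylinder (simplex_space p)) (simplex_space p) h"
      by (auto simp: continuous_map_in_subtopology)
  qed (auto simp: h_def)
  then show ?thesis
    unfolding contractible_space_def by blast
qed

lemma contractible_cylinder: "contractible_space X \<Longrightarrow> contractible_space (cylinder X)"
proof -
  have "contractible_space (top_of_set {0..1::real})"
    unfolding contractible_space_top_of_set by (rule convex_imp_contractible [OF convex_real_interval(5)])
  then show "contractible_space (cylinder X)" if "contractible_space X"
    using that by (simp add: contractible_space_prod_topology)
qed

text \<open>
  A contraction to \<open>a\<close> makes \<open>z\<close> homologous to its image in the one-point space \<open>{a}\<close>, where every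
  cycle of positive degree bounds.
\<close>

lemma contractible_imp_acyclic:
  assumes X: "contractible_space X" and p: "1 \<le> p"
    and z: "singular_chain p X z" "chain_boundary p z = 0"
  shows "singular_relboundary p X {} z"
proof (cases "topspace X = {}")
  case True
  then show ?thesis
    using z(1) by (simp add: singular_chain_empty)
next
  case False
  then obtain a where a: "a \<in> topspace X" and hom: "homotopic_with (\<lambda>x. True) X X id (\<lambda>x. a)"
    using X contractible_space_alt by fastforce
  have "homologous_rel p X {} (chain_map p id z) (chain_map p (\<lambda>x. a) z)"
    using homotopic_imp_homologous_rel_chain_maps [of "{}" "{}" X X id "\<lambda>x. a" p z] hom z
    by (simp add: singular_cycle)
  then have *: "singular_relboundary p X {} (z - chain_map p (\<lambda>x. a) z)"
    using z(1) by (simp add: homologous_rel_def chain_map_ident)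
  have "continuous_map X (subtopology X {a}) (\<lambda>x. a)"
    using a by (simp add: continuous_map_in_subtopology)
  then have "singular_relcycle p (subtopology X {a}) {} (chain_map p (\<lambda>x. a) z)"
    using z by (intro singular_relcycle_chain_map [where X = X and S = "{}"]) (auto simp: singular_cycle)
  then have "singular_relboundary p (subtopology X {a}) {} (chain_map p (\<lambda>x. a) z)"
    using a p by (subst singular_boundary_eq_cycle_singleton [of _ a]) auto
  then have "singular_relboundary p X {} (chain_map p (\<lambda>x. a) z)"
    unfolding singular_boundary using singular_chain_mono [of _ X "{a}" _ UNIV] by auto
  with * show ?thesis
    using singular_relboundary_add by fastforce
qed

lemma continuous_map_cylinder_map:
  "continuous_map X Y f \<Longrightarrow> continuous_map (cylinder X) (cylinder Y) (cylinder_map f)"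
  by (simp add: continuous_map_prod_top)

lemma continuous_map_Pair_cylinder:
  "t \<in> {0..1} \<Longrightarrow> continuous_map X (cylinder X) (Pair t)"
  by (auto intro: continuous_intros)

lemma continuous_map_singular_simplex:
  "singular_simplex p X \<sigma> \<Longrightarrow> continuous_map (simplex_space p) X \<sigma>"
  by (simp add: singular_simplex_def)

lemma singular_chain_standard_chain: "singular_chain p (simplex_space p) (standard_chain p)"
  by (simp add: singular_chain_of singular_simplex_def continuous_map_in_subtopology topspace_standard_simplex)

lemma singular_chain_prism_extend:
  assumes "singular_chain (Suc p) (cylinder (simplex_space p)) P" "singular_chain p X c"
  shows "singular_chain (Suc p) (cylinder X) (prism_extend p P c)"
proof (rule singular_chain_extend)
  fix \<sigma> assume "\<sigma> \<in> Poly_Mapping.keys c"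
  then have "singular_simplex p X \<sigma>"
    using assms(2) by (auto simp: singular_chain_def)
  then show "singular_chain (Suc p) (cylinder X) (chain_map (Suc p) (cylinder_map \<sigma>) P)"
    by (intro singular_chain_chain_map [OF assms(1)] continuous_map_cylinder_map continuous_map_singular_simplex)
qed

lemma prism_extend_natural:
  assumes P: "singular_chain (Suc p) (cylinder (simplex_space p)) P"
  shows "chain_map (Suc p) (cylinder_map f) (prism_extend p P c) = prism_extend p P (chain_map p f c)"
  using subset_UNIV
proof (induction c rule: frag_induction)
  case (one \<sigma>)
  have "cylinder_map f (cylinder_map \<sigma> z) = cylinder_map (simplex_map p f \<sigma>) z"
    if "z \<in> topspace (cylinder (simplex_space p))" for z
    using that by (auto simp: simplex_map_def)
  then show ?case
    using chain_map_eq [OF P, of "cylinder_map f \<circ> cylinder_map \<sigma>"]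
    by (simp add: chain_map_compose)
qed (auto simp: frag_extend_diff chain_map_diff)

text \<open>
  The boundary formula need only be checked on the identity simplex of \<open>\<Delta>\<^sup>p\<close>: naturality carries it
  along \<open>id \<times> \<sigma>\<close> to every singular simplex.  For \<open>p = 0\<close> the truncated \<open>p - 1\<close> is \<open>0\<close>, and the
  last term vanishes because boundaries of \<open>0\<close>-chains do.
\<close>

lemma chain_boundary_prism_extend:
  assumes P: "singular_chain (Suc p) (cylinder (simplex_space p)) P"
    and Q: "singular_chain (Suc (p - 1)) (cylinder (simplex_space (p - 1))) Q"
    and bd: "chain_boundary (Suc p) P =
        chain_map p (Pair 1) (standard_chain p) - chain_map p (Pair 0) (standard_chain p)
        - prism_extend (p - 1) Q (chain_boundary p (standard_chain p))"
    and c: "singular_chain p X c"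
  shows "chain_boundary (Suc p) (prism_extend p P c) =
         chain_map p (Pair 1) c - chain_map p (Pair 0) c - prism_extend (p - 1) Q (chain_boundary p c)"
  using c unfolding singular_chain_def
proof (induction c rule: frag_induction)
  case (one \<sigma>)
  then have \<sigma>: "chain_map p \<sigma> (standard_chain p) = frag_of \<sigma>"
    by (simp add: singular_simplex_chain_map_id del: chain_map_of)
  have ends: "chain_map p (cylinder_map \<sigma>) (chain_map p (Pair t) (standard_chain p))
      = chain_map p (Pair t) (frag_of \<sigma>)" for t
  proof -
    have "cylinder_map \<sigma> \<circ> Pair t = Pair t \<circ> \<sigma>"
      by auto
    then show ?thesis
      by (metis \<sigma> chain_map_compose comp_apply)
  qed
  have "p = 0 \<or> chain_map (p - 1) \<sigma> (chain_boundary p (standard_chain p)) = chain_boundary p (frag_of \<sigma>)"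
    using chain_boundary_chain_map [OF singular_chain_standard_chain, of p \<sigma>] \<sigma> by simp
  then have faces: "chain_map p (cylinder_map \<sigma>) (prism_extend (p - 1) Q (chain_boundary p (standard_chain p)))
      = prism_extend (p - 1) Q (chain_boundary p (frag_of \<sigma>))"
  proof (elim disjE)
    assume "p = 0"
    then show ?thesis
      by (simp add: chain_boundary_def)
  next
    assume "chain_map (p - 1) \<sigma> (chain_boundary p (standard_chain p)) = chain_boundary p (frag_of \<sigma>)"
    then show ?thesis
      using prism_extend_natural [OF Q, of \<sigma> "chain_boundary p (standard_chain p)"]
      by (cases "p = 0") (simp_all add: chain_boundary_def)
  qed
  have "chain_boundary (Suc p) (prism_extend p P (frag_of \<sigma>))
      = chain_map p (cylinder_map \<sigma>) (chain_boundary (Suc p) P)"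
    using chain_boundary_chain_map [OF P, of "cylinder_map \<sigma>"] by simp
  then show ?case
    unfolding bd chain_map_diff ends faces .
qed (auto simp: frag_extend_diff chain_map_diff chain_boundary_diff)

text \<open>
  The identity of \<open>I \<times> X\<close> is a homotopy between the two end inclusions.  This fills the prism in
  degree \<open>0\<close>, where contractibility alone does not make cycles bound.
\<close>

lemma homologous_cylinder_ends:
  assumes "singular_relcycle p X {} c"
  shows "singular_relboundary p (cylinder X) {} (chain_map p (Pair 1) c - chain_map p (Pair 0) c)"
proof -
  have "homotopic_with (\<lambda>h. h \<in> {} \<rightarrow> {}) X (cylinder X) (Pair 0) (Pair 1)"
    unfolding homotopic_with_def by (rule exI [where x = id]) auto
  then have "homologous_rel p (cylinder X) {} (chain_map p (Pair 0) c) (chain_map p (Pair 1) c)"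
    using assms by (rule homotopic_imp_homologous_rel_chain_maps)
  then have "homologous_rel p (cylinder X) {} (chain_map p (Pair 1) c) (chain_map p (Pair 0) c)"
    by (simp only: homologous_rel_sym)
  then show ?thesis
    by (simp only: homologous_rel_def)
qed

text \<open>
  The recursion carries along the consequence of the boundary formula for cycles in \<open>\<Delta>\<^sup>p\<^sup>+\<^sup>1\<close>.  Applied
  to the cycle \<open>\<partial>\<iota>\<close>, where \<open>\<iota>\<close> is the identity simplex of \<open>\<Delta>\<^sup>p\<^sup>+\<^sup>1\<close>, it shows that the boundary
  prescribed in degree \<open>p + 1\<close> is a cycle.
\<close>

lemma natural_prisms:
  obtains P where
    "\<And>p. singular_chain (Suc p) (cylinder (simplex_space p)) (P p)"
    "\<And>p. chain_boundary (Suc p) (P p) =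
        chain_map p (Pair 1) (standard_chain p) - chain_map p (Pair 0) (standard_chain p)
        - prism_extend (p - 1) (P (p - 1)) (chain_boundary p (standard_chain p))"
proof -
  let ?ends = "\<lambda>p c. chain_map p (Pair (1::real)) c - chain_map p (Pair 0) c :: (real \<times> (nat \<Rightarrow> real)) chain"
  let ?G = "\<lambda>p P. singular_chain (Suc p) (cylinder (simplex_space p)) P
      \<and> (p = 0 \<longrightarrow> chain_boundary (Suc p) P = ?ends 0 (standard_chain 0))
      \<and> (\<forall>c. singular_relcycle p (simplex_space (Suc p)) {} c
             \<longrightarrow> chain_boundary (Suc p) (prism_extend p P c) = ?ends p c)"
  let ?Q = "\<lambda>p P P'. chain_boundary (Suc (Suc p)) P' = ?ends (Suc p) (standard_chain (Suc p))
      - prism_extend p P (chain_boundary (Suc p) (standard_chain (Suc p)))"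
  have "\<exists>P. \<forall>p. ?G p (P p) \<and> ?Q p (P p) (P (Suc p))"
  proof (rule dependent_nat_choice)
    \<comment> \<open>Degree \<open>0\<close>: the ends of \<open>I \<times> \<Delta>\<^sup>0\<close> are homologous points.\<close>
    have "singular_relcycle 0 (simplex_space 0) {} (standard_chain 0)"
      by (simp add: singular_cycle singular_chain_standard_chain chain_boundary_def)
    then obtain P where P: "singular_chain (Suc 0) (cylinder (simplex_space 0)) P"
      "chain_boundary (Suc 0) P = ?ends 0 (standard_chain 0)"
      using homologous_cylinder_ends unfolding singular_boundary by metis
    then have "chain_boundary (Suc 0) (prism_extend 0 P c) = ?ends 0 c"
      if "singular_relcycle 0 (simplex_space (Suc 0)) {} c" for c
      using chain_boundary_prism_extend [of 0 P 0 "simplex_space (Suc 0)" c] that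
      by (simp add: singular_cycle chain_boundary_def [of 0])
    with P show "\<exists>P. ?G 0 P"
      by blast
  next
    \<comment> \<open>Degree \<open>p + 1\<close>: the prescribed boundary \<open>?z\<close> is a cycle of positive degree in a contractible space.\<close>
    fix P p assume G: "?G p P"
    let ?z = "?ends (Suc p) (standard_chain (Suc p))
      - prism_extend p P (chain_boundary (Suc p) (standard_chain (Suc p)))"
    note std = singular_chain_standard_chain [of "Suc p"]
    have cyc: "singular_relcycle p (simplex_space (Suc p)) {} c"
      if "c = chain_boundary (Suc p) d" "singular_chain (Suc p) (simplex_space (Suc p)) d" for c d
      using that chain_boundary_boundary_alt [of p "simplex_space (Suc p)" d]
      by (simp add: singular_cycle singular_chain_boundary_alt)
    have "singular_chain (Suc p) (cylinder (simplex_space (Suc p))) ?z"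
      using G std singular_chain_boundary_alt [OF std]
      by (intro singular_chain_diff singular_chain_chain_map [OF std] singular_chain_prism_extend
          continuous_map_Pair_cylinder) auto
    moreover have "chain_boundary (Suc p) ?z = 0"
      using G cyc [OF refl std]
      by (simp add: chain_boundary_diff chain_boundary_chain_map [OF std] del: chain_map_of)
    ultimately have "singular_relboundary (Suc p) (cylinder (simplex_space (Suc p))) {} ?z"
      by (intro contractible_imp_acyclic contractible_cylinder contractible_simplex_space) auto
    then obtain P' where P': "singular_chain (Suc (Suc p)) (cylinder (simplex_space (Suc p))) P'"
      "chain_boundary (Suc (Suc p)) P' = ?z"
      unfolding singular_boundary by blast
    then have "chain_boundary (Suc (Suc p)) (prism_extend (Suc p) P' c) = ?ends (Suc p) c"
      if "singular_relcycle (Suc p) (simplex_space (Suc (Suc p))) {} c" for c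
      using chain_boundary_prism_extend [of "Suc p" P' P "simplex_space (Suc (Suc p))" c] that G
      by (simp add: singular_cycle)
    with P' show "\<exists>P'. ?G (Suc p) P' \<and> ?Q p P P'"
      by auto
  qed
  then obtain P where P: "\<And>p. ?G p (P p)" "\<And>p. ?Q p (P p) (P (Suc p))"
    by blast
  show thesis
  proof (rule that)
    fix p
    show "singular_chain (Suc p) (cylinder (simplex_space p)) (P p)"
      using P(1) by blast
    show "chain_boundary (Suc p) (P p) = ?ends p (standard_chain p)
        - prism_extend (p - 1) (P (p - 1)) (chain_boundary p (standard_chain p))"
      using P(1) [of p] P(2) [of "p - 1"] by (cases p) (auto simp: chain_boundary_def [of 0])
  qed
qed

text \<open>
  The homotopy \<open>I \<times> X \<rightarrow> Y\<close> maps the prism over each simplex to \<open>Y\<close>.  Homologous images of integral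
  cycles would not suffice below: a cycle with coefficients need not be a combination of integral
  cycles, so the operator has to be available on each single simplex.
\<close>

lemma homotopic_imp_integral_chain_homotopy:
  assumes "homotopic_with (\<lambda>_. True) X Y f g"
  obtains H where
    "\<And>p \<sigma>. singular_simplex p X \<sigma> \<Longrightarrow> singular_chain (Suc p) Y (H p \<sigma>)"
    "\<And>p \<sigma>. singular_simplex p X \<sigma> \<Longrightarrow>
       chain_boundary (Suc p) (H p \<sigma>) =
         chain_map p g (frag_of \<sigma>) - chain_map p f (frag_of \<sigma>)
         - frag_extend (H (p - 1)) (chain_boundary p (frag_of \<sigma>))"
proof -
  obtain h where h: "continuous_map (cylinder X) Y h"
    and h01: "h \<circ> Pair 0 = f" "h \<circ> Pair 1 = g"
    using assms by (force simp: homotopic_with_def)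
  obtain P where P: "\<And>p. singular_chain (Suc p) (cylinder (simplex_space p)) (P p)"
    "\<And>p. chain_boundary (Suc p) (P p) =
        chain_map p (Pair 1) (standard_chain p) - chain_map p (Pair 0) (standard_chain p)
        - prism_extend (p - 1) (P (p - 1)) (chain_boundary p (standard_chain p))"
    using natural_prisms by blast
  define H where "H p \<sigma> = chain_map (Suc p) h (prism_extend p (P p) (frag_of \<sigma>))" for p \<sigma>
  have H: "frag_extend (H p) c = chain_map (Suc p) h (prism_extend p (P p) c)" for p c
    using subset_UNIV by (induction c rule: frag_induction) (auto simp: H_def frag_extend_diff chain_map_diff)
  show thesis
  proof (rule that)
    fix p \<sigma> assume "singular_simplex p X \<sigma>"
    then have \<sigma>: "singular_chain p X (frag_of \<sigma>)"
      by (simp add: singular_chain_of)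
    have Q: "singular_chain (Suc p) (cylinder X) (prism_extend p (P p) (frag_of \<sigma>))"
      by (intro singular_chain_prism_extend P \<sigma>)
    then show "singular_chain (Suc p) Y (H p \<sigma>)"
      unfolding H_def using h by (rule singular_chain_chain_map)
    have ends: "chain_map p h (chain_map p (Pair t) c) = chain_map p (h \<circ> Pair t) c" for t c
      by (simp add: chain_map_compose)
    have faces: "chain_map p h (prism_extend (p - 1) (P (p - 1)) (chain_boundary p (frag_of \<sigma>)))
        = frag_extend (H (p - 1)) (chain_boundary p (frag_of \<sigma>))"
      by (cases "p = 0") (simp_all add: H chain_boundary_def [of 0])
    have "chain_boundary (Suc p) (H p \<sigma>)
        = chain_map p h (chain_boundary (Suc p) (prism_extend p (P p) (frag_of \<sigma>)))"
      unfolding H_def using chain_boundary_chain_map [OF Q] by simp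
    also have "\<dots> = chain_map p g (frag_of \<sigma>) - chain_map p f (frag_of \<sigma>)
         - frag_extend (H (p - 1)) (chain_boundary p (frag_of \<sigma>))"
      unfolding chain_boundary_prism_extend [OF P(1) P(1) P(2) \<sigma>] chain_map_diff ends h01 faces ..
    finally show "chain_boundary (Suc p) (H p \<sigma>) =
         chain_map p g (frag_of \<sigma>) - chain_map p f (frag_of \<sigma>)
         - frag_extend (H (p - 1)) (chain_boundary p (frag_of \<sigma>))" .
  qed
qed


section \<open>Chains with coefficients\<close>

text \<open>
  With coefficients the generators are the chains \<open>r \<sigma>\<close>, for all \<open>r\<close>; the induction rule for integral
  chains only has \<open>\<sigma>\<close> itself.
\<close>

lemma rchain_induct [consumes 1, case_names single add]:
  fixes c :: "'k \<Rightarrow>\<^sub>0 'r::ab_group_add"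
  assumes c: "Poly_Mapping.keys c \<subseteq> S"
    and single: "\<And>k r. k \<in> S \<Longrightarrow> P (Poly_Mapping.single k r)"
    and add: "\<And>a b. P a \<Longrightarrow> P b \<Longrightarrow> P (a + b)"
    and zero: "P 0"
  shows "P c"
proof -
  have "P (\<Sum>k\<in>I. Poly_Mapping.single k (Poly_Mapping.lookup c k))"
    if "finite I" "I \<subseteq> S" for I
    using that by (induction I rule: finite_induct) (auto simp: zero intro: single add)
  moreover have "c = (\<Sum>k\<in>Poly_Mapping.keys c. Poly_Mapping.single k (Poly_Mapping.lookup c k))"
    by (rule poly_mapping_eqI) (simp add: lookup_sum lookup_single when_def in_keys_iff)
  ultimately show ?thesis
    using c by (metis finite_keys)
qed

text \<open>
  The element \<open>c \<otimes> r\<close> of \<open>C\<^sub>p(X; \<int>) \<otimes> R = C\<^sub>p(X; R)\<close>.  Without a unit in \<open>R\<close> the integer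
  multiple \<open>n r\<close> is not a product in \<open>R\<close>, so the map is specified by the universal property of the
  free abelian group of integral chains.
\<close>

definition tensor_chain :: "'r::ring \<Rightarrow> 'a chain \<Rightarrow> ('a, 'r) rchain"
  where "tensor_chain r = (SOME T. (\<forall>a b. T (a + b) = T a + T b)
    \<and> (\<forall>\<sigma>. T (frag_of \<sigma>) = Poly_Mapping.single \<sigma> r))"

lemma
  fixes r :: "'r::ring" and a b :: "'a chain"
  shows tensor_chain_add: "tensor_chain r (a + b) = tensor_chain r a + tensor_chain r b"
    and tensor_chain_of: "tensor_chain r (frag_of \<sigma> :: 'a chain) = Poly_Mapping.single \<sigma> r"
proof -
  let ?G = "\<lparr>carrier = UNIV, monoid.mult = (+), one = 0 :: ('a, 'r) rchain\<rparr>"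
  have "comm_group ?G"
    by (rule comm_groupI) (auto simp: add_ac intro: exI [of _ "- _"] left_minus)
  then interpret comm_group ?G .
  obtain T where T: "T \<in> hom (free_Abelian_group UNIV) ?G"
    and of: "\<And>\<sigma>. T (frag_of \<sigma>) = Poly_Mapping.single \<sigma> r"
    using free_Abelian_group_universal [of "\<lambda>\<sigma>. Poly_Mapping.single \<sigma> r" UNIV] by auto
  have "T (a + b) = T a + T b" for a b
    using hom_mult [OF T, of a b] by simp
  with of have ex: "\<exists>T :: 'a chain \<Rightarrow> ('a, 'r) rchain.
      (\<forall>a b. T (a + b) = T a + T b) \<and> (\<forall>\<sigma>. T (frag_of \<sigma>) = Poly_Mapping.single \<sigma> r)"
    by (intro exI [of _ T]) simp
  show "tensor_chain r (a + b) = tensor_chain r a + tensor_chain r b"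
    "tensor_chain r (frag_of \<sigma> :: 'a chain) = Poly_Mapping.single \<sigma> r"
    using someI_ex [OF ex] unfolding tensor_chain_def by blast+
qed

interpretation tensor_chain: additive "tensor_chain r" for r
  by unfold_locales (rule tensor_chain_add)

lemma tensor_chain_add_coefficient: "tensor_chain (r + s) c = tensor_chain r c + tensor_chain s c"
  using subset_UNIV
  by (induction c rule: frag_induction) (auto simp: tensor_chain.zero tensor_chain_of tensor_chain.diff single_add)

lemma tensor_chain_zero_coefficient: "tensor_chain 0 c = 0"
  using tensor_chain_add_coefficient [of 0 0 c] by simp

lemma keys_tensor_chain: "Poly_Mapping.keys (tensor_chain r c) \<subseteq> Poly_Mapping.keys c"
proof -
  have "Poly_Mapping.keys (tensor_chain r c) \<subseteq> S" if "Poly_Mapping.keys c \<subseteq> S" for S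
    using that
  proof (induction c rule: frag_induction)
    case (diff a b)
    then show ?case
      using keys_diff [of "tensor_chain r a"] by (auto simp: tensor_chain.diff)
  qed (auto simp: tensor_chain.zero tensor_chain_of)
  then show ?thesis
    by blast
qed

text \<open>
  The operator \<open>H \<otimes> id\<close> on chains with coefficients, for \<open>H\<close> given on the free generators of the
  integral chain group.  Boundary, induced map and chain homotopy all have this form, so identities
  between them are inherited from the integers.
\<close>

definition tensor_operator :: "(((nat \<Rightarrow> real) \<Rightarrow> 'a) \<Rightarrow> 'b chain) \<Rightarrow> ('a, 'r::ring) rchain \<Rightarrow> ('b, 'r) rchain"
  where "tensor_operator H c = (\<Sum>\<sigma>\<in>Poly_Mapping.keys c. tensor_chain (Poly_Mapping.lookup c \<sigma>) (H \<sigma>))"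

lemma tensor_operator_add: "tensor_operator H (a + b) = tensor_operator H a + tensor_operator H b"
  unfolding tensor_operator_def
  by (rule setsum_keys_plus_distrib) (auto simp: tensor_chain_add_coefficient tensor_chain_zero_coefficient)

interpretation tensor_operator: additive "tensor_operator H" for H
  by unfold_locales (rule tensor_operator_add)

lemma tensor_operator_single: "tensor_operator H (Poly_Mapping.single \<sigma> r) = tensor_chain r (H \<sigma>)"
  by (simp add: tensor_operator_def tensor_chain_zero_coefficient)

lemma tensor_operator_tensor: "tensor_operator H (tensor_chain r c) = tensor_chain r (frag_extend H c)"
  using subset_UNIV
  by (induction c rule: frag_induction)
     (simp_all add: tensor_chain.zero tensor_operator.zero tensor_chain.diff tensor_operator.diff frag_extend_diff
        tensor_chain_of tensor_operator_single)

lemma rchain_boundary_eq_tensor_operator: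
  "(rchain_boundary p :: ('a, 'r::ring) rchain \<Rightarrow> _) = tensor_operator (\<lambda>\<sigma>. chain_boundary p (frag_of \<sigma>))"
proof (rule ext)
  fix c :: "('a, 'r) rchain"
  have sign: "tensor_chain r (frag_cmul ((-1) ^ k) (frag_of \<tau>)) = Poly_Mapping.single \<tau> (if even k then r else - r)"
    for k and r :: 'r and \<tau> :: "(nat \<Rightarrow> real) \<Rightarrow> 'a"
    by (simp add: tensor_chain_of tensor_chain.minus single_uminus)
  show "rchain_boundary p c = tensor_operator (\<lambda>\<sigma>. chain_boundary p (frag_of \<sigma>)) c"
    by (cases "p = 0")
       (simp_all add: rchain_boundary_def tensor_operator_def chain_boundary_of tensor_chain.zero
         tensor_chain.sum sign del: minus_frag_cmul)
qed

lemma rchain_map_eq_tensor_operator: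
  "rchain_map p f = tensor_operator (\<lambda>\<sigma>. chain_map p f (frag_of \<sigma>))"
  by (rule ext) (simp add: rchain_map_def tensor_operator_def tensor_chain_of)

interpretation rchain_boundary: additive "rchain_boundary p" for p
  by unfold_locales (simp add: rchain_boundary_eq_tensor_operator tensor_operator_add)

interpretation rchain_map: additive "rchain_map p f" for p f
  by unfold_locales (simp add: rchain_map_eq_tensor_operator tensor_operator_add)

lemma rchain_boundary_single:
  "rchain_boundary p (Poly_Mapping.single \<sigma> r) = tensor_chain r (chain_boundary p (frag_of \<sigma>))"
  by (simp add: rchain_boundary_eq_tensor_operator tensor_operator_single)

lemma rchain_map_single:
  "rchain_map p f (Poly_Mapping.single \<sigma> r) = Poly_Mapping.single (simplex_map p f \<sigma>) r"
  by (simp add: rchain_map_eq_tensor_operator tensor_operator_single tensor_chain_of)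

lemma rchain_boundary_tensor: "rchain_boundary p (tensor_chain r c) = tensor_chain r (chain_boundary p c)"
proof -
  have "frag_extend (\<lambda>\<sigma>. chain_boundary p (frag_of \<sigma>)) c = chain_boundary p c"
    by (cases "p = 0") (simp_all add: chain_boundary_def frag_extend_eq_0)
  then show ?thesis
    by (simp add: rchain_boundary_eq_tensor_operator tensor_operator_tensor)
qed

lemma rchain_map_tensor: "rchain_map p f (tensor_chain r c) = tensor_chain r (chain_map p f c)"
  by (simp add: rchain_map_eq_tensor_operator tensor_operator_tensor) (simp add: chain_map_def o_def)

lemma rchain_boundary_boundary:
  assumes "Poly_Mapping.keys c \<subseteq> singular_simplex_set (Suc p) X"
  shows "rchain_boundary p (rchain_boundary (Suc p) c) = 0"
  using assms
proof (induction c rule: rchain_induct)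
  case (single \<sigma> r)
  then have "chain_boundary p (chain_boundary (Suc p) (frag_of \<sigma>)) = 0"
    by (intro chain_boundary_boundary_alt) (auto simp: singular_chain_of)
  then show ?case
    by (simp add: rchain_boundary_single rchain_boundary_tensor tensor_chain.zero)
qed (simp_all add: rchain_boundary.add rchain_boundary.zero)

lemma rchain_boundary_map:
  assumes "Poly_Mapping.keys c \<subseteq> singular_simplex_set p X"
  shows "rchain_boundary p (rchain_map p f c) = rchain_map (p - 1) f (rchain_boundary p c)"
  using assms
proof (induction c rule: rchain_induct)
  case (single \<sigma> r)
  then have "chain_boundary p (chain_map p f (frag_of \<sigma>)) = chain_map (p - 1) f (chain_boundary p (frag_of \<sigma>))"
    using chain_boundary_chain_map [of p X "frag_of \<sigma>" f] by (simp add: singular_chain_of)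
  then show ?case
    by (simp add: rchain_map_single rchain_boundary_single rchain_map_tensor)
qed (simp_all add: rchain_boundary.add rchain_boundary.zero rchain_map.add rchain_map.zero)

lemma keys_rchain_boundary:
  assumes "Poly_Mapping.keys c \<subseteq> singular_simplex_set (Suc p) X"
  shows "Poly_Mapping.keys (rchain_boundary (Suc p) c) \<subseteq> singular_simplex_set p X"
  using assms
proof (induction c rule: rchain_induct)
  case (single \<sigma> r)
  then have "singular_chain p X (chain_boundary (Suc p) (frag_of \<sigma>))"
    by (intro singular_chain_boundary_alt) (auto simp: singular_chain_of)
  then show ?case
    using keys_tensor_chain unfolding rchain_boundary_single singular_chain_def by blast
next
  case (add a b)
  then show ?case
    using keys_add [of "rchain_boundary (Suc p) a"] by (auto simp: rchain_boundary.add)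
qed (auto simp: rchain_boundary.zero)

lemma keys_rchain_map:
  assumes "Poly_Mapping.keys c \<subseteq> singular_simplex_set p X" "continuous_map X Y f"
  shows "Poly_Mapping.keys (rchain_map p f c) \<subseteq> singular_simplex_set p Y"
  using assms(1)
proof (induction c rule: rchain_induct)
  case (single \<sigma> r)
  then show ?case
    using assms(2) by (auto simp: rchain_map_single singular_simplex_simplex_map)
next
  case (add a b)
  then show ?case
    using keys_add [of "rchain_map p f a"] by (auto simp: rchain_map.add)
qed (auto simp: rchain_map.zero)

lemma rchain_map_compose: "rchain_map p (g \<circ> f) c = rchain_map p g (rchain_map p f c)"
  using subset_UNIV
proof (induction c rule: rchain_induct)
  case (single \<sigma> r)
  show ?case
    unfolding rchain_map_single simplex_map_compose by simp
qed (simp_all add: rchain_map.add rchain_map.zero)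

text \<open>
  Tensoring the integral chain homotopy with the ring; both sides of the boundary formula are
  additive, so it is enough to compare them on \<open>r \<sigma>\<close>.
\<close>

lemma homotopic_imp_rchain_homotopy:
  assumes "homotopic_with (\<lambda>_. True) X Y f g"
  obtains D :: "nat \<Rightarrow> ('a, 'r::ring) rchain \<Rightarrow> ('b, 'r) rchain" where
    "\<And>p c. Poly_Mapping.keys c \<subseteq> singular_simplex_set p X
       \<Longrightarrow> Poly_Mapping.keys (D p c) \<subseteq> singular_simplex_set (Suc p) Y"
    "\<And>p c. Poly_Mapping.keys c \<subseteq> singular_simplex_set p X
       \<Longrightarrow> rchain_boundary (Suc p) (D p c) =
           rchain_map p g c - rchain_map p f c - D (p - 1) (rchain_boundary p c)"
    "\<And>p. D p 0 = 0"
proof -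
  obtain H where H:
    "\<And>p \<sigma>. singular_simplex p X \<sigma> \<Longrightarrow> singular_chain (Suc p) Y (H p \<sigma>)"
    "\<And>p \<sigma>. singular_simplex p X \<sigma> \<Longrightarrow>
       chain_boundary (Suc p) (H p \<sigma>) =
         chain_map p g (frag_of \<sigma>) - chain_map p f (frag_of \<sigma>)
         - frag_extend (H (p - 1)) (chain_boundary p (frag_of \<sigma>))"
    using homotopic_imp_integral_chain_homotopy [OF assms] by blast
  show thesis
  proof (rule that [of "\<lambda>p. tensor_operator (H p)"])
    fix p and c :: "('a, 'r) rchain"
    assume c: "Poly_Mapping.keys c \<subseteq> singular_simplex_set p X"
    then show "Poly_Mapping.keys (tensor_operator (H p) c) \<subseteq> singular_simplex_set (Suc p) Y"
    proof (induction c rule: rchain_induct)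
      case (single \<sigma> r)
      then show ?case
        using H(1) [of p \<sigma>] keys_tensor_chain unfolding tensor_operator_single singular_chain_def by blast
    next
      case (add a b)
      then show ?case
        using keys_add [of "tensor_operator (H p) a"] by (auto simp: tensor_operator_add)
    qed (auto simp: tensor_operator.zero)
    show "rchain_boundary (Suc p) (tensor_operator (H p) c) =
        rchain_map p g c - rchain_map p f c - tensor_operator (H (p - 1)) (rchain_boundary p c)"
      using c
    proof (induction c rule: rchain_induct)
      case (single \<sigma> r)
      then have \<sigma>: "singular_simplex p X \<sigma>"
        by simp
      show ?case
        unfolding tensor_operator_single rchain_boundary_tensor H(2) [OF \<sigma>] tensor_chain.diff
          rchain_boundary_single tensor_operator_tensor
        by (simp only: rchain_map_single chain_map_of tensor_chain_of)
    next
      case (add a b)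
      then show ?case
        unfolding tensor_operator_add rchain_boundary.add rchain_map.add by (simp only: add_diff_add)
    qed (simp add: tensor_operator.zero rchain_boundary.zero rchain_map.zero)
  qed (rule tensor_operator.zero)
qed


section \<open>Homology with coefficients as a functor to groups\<close>

lemma carrier_rcycle_group:
  "c \<in> carrier (rcycle_group p X) \<longleftrightarrow>
     Poly_Mapping.keys c \<subseteq> singular_simplex_set p X \<and> rchain_boundary p c = 0"
  by (simp add: rcycle_group_def rchain_group_def)

lemma rcycle_group_simps [simp]:
  "\<one>\<^bsub>rcycle_group p X\<^esub> = 0" "a \<otimes>\<^bsub>rcycle_group p X\<^esub> b = a + b"
  by (simp_all add: rcycle_group_def rchain_group_def)

lemma comm_group_rcycle_group: "comm_group (rcycle_group p X)"
proof (rule comm_groupI)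
  fix a b :: "('a, 'b) rchain"
  assume "a \<in> carrier (rcycle_group p X)" "b \<in> carrier (rcycle_group p X)"
  then show "a \<otimes>\<^bsub>rcycle_group p X\<^esub> b \<in> carrier (rcycle_group p X)"
    using keys_add [of a b] by (auto simp: carrier_rcycle_group rchain_boundary.add)
next
  fix a :: "('a, 'b) rchain"
  assume "a \<in> carrier (rcycle_group p X)"
  then show "\<exists>b \<in> carrier (rcycle_group p X). b \<otimes>\<^bsub>rcycle_group p X\<^esub> a = \<one>\<^bsub>rcycle_group p X\<^esub>"
    by (intro bexI [of _ "- a"]) (auto simp: carrier_rcycle_group rchain_boundary.minus)
qed (auto simp: carrier_rcycle_group rchain_boundary.zero add_ac)

lemma inv_rcycle_group:
  assumes "a \<in> carrier (rcycle_group p X)"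
  shows "inv\<^bsub>rcycle_group p X\<^esub> a = - a"
proof -
  interpret comm_group "rcycle_group p X"
    by (rule comm_group_rcycle_group)
  show ?thesis
    using assms by (intro inv_equality) (auto simp: carrier_rcycle_group rchain_boundary.minus)
qed

lemma rboundary_setE:
  assumes "b \<in> rboundary_set p X"
  obtains d where "Poly_Mapping.keys d \<subseteq> singular_simplex_set (Suc p) X" "b = rchain_boundary (Suc p) d"
  using assms by (auto simp: rboundary_set_def rchain_group_def)

lemma rboundary_setI:
  "Poly_Mapping.keys d \<subseteq> singular_simplex_set (Suc p) X \<Longrightarrow> rchain_boundary (Suc p) d \<in> rboundary_set p X"
  by (auto simp: rboundary_set_def rchain_group_def)

lemma subgroup_rboundary_set:
  "subgroup (rboundary_set p X :: ('a, 'r::ring) rchain set) (rcycle_group p X)"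
proof
  show sub: "(rboundary_set p X :: ('a, 'r) rchain set) \<subseteq> carrier (rcycle_group p X)"
    by (auto elim!: rboundary_setE simp: carrier_rcycle_group rchain_boundary_boundary
        dest: subsetD [OF keys_rchain_boundary])
  show "\<one>\<^bsub>rcycle_group p X\<^esub> \<in> rboundary_set p X"
    using rboundary_setI [of 0] by (simp add: rchain_boundary.zero)
  fix a b :: "('a, 'r) rchain"
  assume a: "a \<in> rboundary_set p X"
  then obtain d where d: "Poly_Mapping.keys d \<subseteq> singular_simplex_set (Suc p) X" "a = rchain_boundary (Suc p) d"
    by (rule rboundary_setE)
  show "inv\<^bsub>rcycle_group p X\<^esub> a \<in> rboundary_set p X"
    using rboundary_setI [of "- d" p X] d inv_rcycle_group [OF subsetD [OF sub a]]
    by (simp add: rchain_boundary.minus)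
  assume "b \<in> rboundary_set p X"
  then obtain e where e: "Poly_Mapping.keys e \<subseteq> singular_simplex_set (Suc p) X" "b = rchain_boundary (Suc p) e"
    by (rule rboundary_setE)
  have "Poly_Mapping.keys (d + e) \<subseteq> singular_simplex_set (Suc p) X"
    using d e keys_add [of d e] by blast
  then show "a \<otimes>\<^bsub>rcycle_group p X\<^esub> b \<in> rboundary_set p X"
    using rboundary_setI d e by (simp add: rchain_boundary.add [symmetric])
qed

lemma normal_rboundary_set: "rboundary_set p X \<lhd> rcycle_group p X"
  by (rule comm_group.subgroup_imp_normal [OF comm_group_rcycle_group subgroup_rboundary_set])

abbreviation rhomology_class :: "nat \<Rightarrow> 'a topology \<Rightarrow> ('a, 'r::ring) rchain \<Rightarrow> ('a, 'r) rchain set"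
  where "rhomology_class p X c \<equiv> rboundary_set p X #>\<^bsub>rcycle_group p X\<^esub> c"

lemma rhomology_class_eqI:
  assumes "a \<in> carrier (rcycle_group p X)" "b \<in> carrier (rcycle_group p X)" "a - b \<in> rboundary_set p X"
  shows "rhomology_class p X a = rhomology_class p X b"
proof -
  interpret comm_group "rcycle_group p X"
    by (rule comm_group_rcycle_group)
  have "a \<in> rhomology_class p X b"
    using assms(3) by (force simp: r_coset_def)
  then show ?thesis
    using repr_independence [OF _ assms(2) subgroup_rboundary_set] by simp
qed

lemma carrier_rhomology_group:
  "carrier (rhomology_group p X) = rhomology_class p X ` carrier (rcycle_group p X)"
  by (simp add: rhomology_group_def carrier_FactGroup)

lemma group_rhomology_group: "group (rhomology_group p X)"
  unfolding rhomology_group_def by (rule normal.factorgroup_is_group [OF normal_rboundary_set])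

lemma rchain_map_in_rcycle_group:
  assumes "c \<in> carrier (rcycle_group p X)" "continuous_map X Y f"
  shows "rchain_map p f c \<in> carrier (rcycle_group p Y)"
  using assms keys_rchain_map [of c p X Y f]
  by (auto simp: carrier_rcycle_group rchain_boundary_map rchain_map.zero)

lemma rchain_map_in_rboundary_set:
  assumes "b \<in> rboundary_set p X" "continuous_map X Y f"
  shows "rchain_map p f b \<in> rboundary_set p Y"
proof -
  obtain d where d: "Poly_Mapping.keys d \<subseteq> singular_simplex_set (Suc p) X" "b = rchain_boundary (Suc p) d"
    using assms(1) by (rule rboundary_setE)
  show ?thesis
    using rboundary_setI [OF keys_rchain_map [OF d(1) assms(2)]] d by (simp add: rchain_boundary_map)
qed

text \<open>
  Induced maps send boundaries to boundaries, so the value on a coset can be read off at any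
  representative.
\<close>

lemma rhomology_map_class:
  assumes c: "c \<in> carrier (rcycle_group p X)" and f: "continuous_map X Y f"
  shows "rhomology_map p Y f (rhomology_class p X c) = rhomology_class p Y (rchain_map p f c)"
proof -
  have "rhomology_class p Y (rchain_map p f c') = rhomology_class p Y (rchain_map p f c)"
    if c': "c' \<in> rhomology_class p X c" for c'
  proof (rule rhomology_class_eqI)
    obtain b where b: "b \<in> rboundary_set p X" "c' = b + c"
      using c' by (auto simp: r_coset_def)
    have "c' \<in> carrier (rcycle_group p X)"
      using b c subgroup.subset [OF subgroup_rboundary_set, of p X]
        monoid.m_closed [OF group.is_monoid [OF comm_group.axioms(2) [OF comm_group_rcycle_group]], of b p X c]
      by auto
    then show "rchain_map p f c' \<in> carrier (rcycle_group p Y)" "rchain_map p f c \<in> carrier (rcycle_group p Y)"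
      using c f by (auto intro: rchain_map_in_rcycle_group)
    show "rchain_map p f c' - rchain_map p f c \<in> rboundary_set p Y"
      using rchain_map_in_rboundary_set [OF b(1) f] b(2) by (simp add: rchain_map.add)
  qed
  moreover have "c \<in> rhomology_class p X c"
    by (meson c comm_group.axioms(2) comm_group_rcycle_group group.rcos_self subgroup_rboundary_set)
  ultimately have "(\<lambda>c. rhomology_class p Y (rchain_map p f c)) ` rhomology_class p X c
      = {rhomology_class p Y (rchain_map p f c)}"
    by blast
  then show ?thesis
    by (simp add: rhomology_map_def)
qed

lemma rhomology_class_add:
  assumes "a \<in> carrier (rcycle_group p X)" "b \<in> carrier (rcycle_group p X)"
  shows "rhomology_class p X a \<otimes>\<^bsub>rhomology_group p X\<^esub> rhomology_class p X b = rhomology_class p X (a + b)"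
  using normal.rcos_sum [OF normal_rboundary_set assms] by (simp add: rhomology_group_def)

lemma rhomology_map_hom:
  assumes f: "continuous_map X Y f"
  shows "rhomology_map p Y f \<in> hom (rhomology_group p X) (rhomology_group p Y)"
proof (rule homI)
  fix A B :: "('a, 'c) rchain set"
  assume "A \<in> carrier (rhomology_group p X)"
  then obtain a where a: "a \<in> carrier (rcycle_group p X)" "A = rhomology_class p X a"
    by (auto simp: carrier_rhomology_group)
  then show "rhomology_map p Y f A \<in> carrier (rhomology_group p Y)"
    by (simp add: carrier_rhomology_group rhomology_map_class [OF _ f] rchain_map_in_rcycle_group [OF _ f])
  assume "B \<in> carrier (rhomology_group p X)"
  then obtain b where b: "b \<in> carrier (rcycle_group p X)" "B = rhomology_class p X b"
    by (auto simp: carrier_rhomology_group)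
  have "a + b \<in> carrier (rcycle_group p X)"
    using a b keys_add [of a b] by (auto simp: carrier_rcycle_group rchain_boundary.add)
  then show "rhomology_map p Y f (A \<otimes>\<^bsub>rhomology_group p X\<^esub> B)
      = rhomology_map p Y f A \<otimes>\<^bsub>rhomology_group p Y\<^esub> rhomology_map p Y f B"
    using a b by (simp add: rhomology_class_add rhomology_map_class [OF _ f] rchain_map_in_rcycle_group [OF _ f] rchain_map.add)
qed

lemma rhomology_map_compose:
  assumes "A \<in> carrier (rhomology_group p X)" "continuous_map X Y f" "continuous_map Y Z g"
  shows "rhomology_map p Z (g \<circ> f) A = rhomology_map p Z g (rhomology_map p Y f A)"
  using assms
  by (auto simp: carrier_rhomology_group rhomology_map_class [of _ p X] rhomology_map_class [of _ p Y]
      continuous_map_compose rchain_map_in_rcycle_group rchain_map_compose simp del: o_apply)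

text \<open>
  On a cycle \<open>c\<close> the chain homotopy formula loses its last term, which leaves \<open>g\<^sub># c - f\<^sub># c\<close> as the
  boundary of \<open>D c\<close>.
\<close>

lemma rhomology_map_homotopic:
  fixes A :: "('a, 'r::ring) rchain set"
  assumes A: "A \<in> carrier (rhomology_group p X)" and hom: "homotopic_with (\<lambda>_. True) X Y f g"
  shows "rhomology_map p Y f A = rhomology_map p Y g A"
proof -
  have fg: "continuous_map X Y f" "continuous_map X Y g"
    using homotopic_with_imp_continuous_maps [OF hom] by auto
  obtain c where c: "c \<in> carrier (rcycle_group p X)" "A = rhomology_class p X c"
    using A by (auto simp: carrier_rhomology_group)
  obtain D :: "nat \<Rightarrow> ('a, 'r) rchain \<Rightarrow> ('b, 'r) rchain" where D:
    "\<And>p c. Poly_Mapping.keys c \<subseteq> singular_simplex_set p X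
       \<Longrightarrow> Poly_Mapping.keys (D p c) \<subseteq> singular_simplex_set (Suc p) Y"
    "\<And>p c. Poly_Mapping.keys c \<subseteq> singular_simplex_set p X
       \<Longrightarrow> rchain_boundary (Suc p) (D p c) =
           rchain_map p g c - rchain_map p f c - D (p - 1) (rchain_boundary p c)"
    "\<And>p. D p 0 = 0"
    using homotopic_imp_rchain_homotopy [OF hom] by blast
  have "rchain_map p g c - rchain_map p f c \<in> rboundary_set p Y"
    using c(1) D rboundary_setI [of "D p c" p Y] by (simp add: carrier_rcycle_group)
  then have "rhomology_class p Y (rchain_map p g c) = rhomology_class p Y (rchain_map p f c)"
    using c(1) fg by (intro rhomology_class_eqI rchain_map_in_rcycle_group)
  then show ?thesis
    using c fg by (simp add: rhomology_map_class)
qed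

lemma carrier_total_homology:
  "carrier (total_homology R X) =
     {z. (\<forall>p. z p \<in> carrier (rhomology_group p X)) \<and> finite {p. z p \<noteq> \<one>\<^bsub>rhomology_group p X\<^esub>}}"
  by (auto simp: total_homology_def carrier_sum_group group_rhomology_group)

text \<open>
  Finite support survives because a homomorphism maps the trivial class to the trivial class.
\<close>

lemma total_homology_map_hom:
  assumes f: "continuous_map X Y f"
  shows "total_homology_map Y f \<in> hom (total_homology R X) (total_homology R Y)"
proof (rule homI)
  fix z w :: "nat \<Rightarrow> ('a, 'c) rchain set"
  assume z: "z \<in> carrier (total_homology R X)"
  have "{p. rhomology_map p Y f (z p) \<noteq> \<one>\<^bsub>rhomology_group p Y\<^esub>} \<subseteq> {p. z p \<noteq> \<one>\<^bsub>rhomology_group p X\<^esub>}"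
    by (auto simp: hom_one [OF rhomology_map_hom [OF f] group_rhomology_group group_rhomology_group])
  then show "total_homology_map Y f z \<in> carrier (total_homology R Y)"
    using z by (auto simp: carrier_total_homology total_homology_map_def
        hom_in_carrier [OF rhomology_map_hom [OF f]] intro: finite_subset)
  assume w: "w \<in> carrier (total_homology R X)"
  show "total_homology_map Y f (z \<otimes>\<^bsub>total_homology R X\<^esub> w)
      = total_homology_map Y f z \<otimes>\<^bsub>total_homology R Y\<^esub> total_homology_map Y f w"
    using z w unfolding total_homology_map_def
    by (simp add: carrier_total_homology hom_mult [OF rhomology_map_hom [OF f]])
       (simp add: total_homology_def hom_mult [OF rhomology_map_hom [OF f]] restrict_def)
qed

lemma group_total_homology: "group (total_homology R X)"
  unfolding total_homology_def by (rule sum_group) (rule group_rhomology_group)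

lemma subgroup_homology_image:
  assumes f: "continuous_map X Y f"
  shows "subgroup (homology_image R X Y f) (total_homology R Y)"
proof -
  interpret group_hom "total_homology R X" "total_homology R Y" "total_homology_map Y f"
    using total_homology_map_hom [OF f] by (simp add: group_hom_def group_hom_axioms_def group_total_homology)
  show ?thesis
    unfolding homology_image_def by (rule img_is_subgroup)
qed

lemma homology_image_homotopic:
  assumes "homotopic_with (\<lambda>_. True) X Y f g"
  shows "homology_image R X Y f = homology_image R X Y g"
  unfolding homology_image_def
proof (rule image_cong [OF refl])
  fix z assume "z \<in> carrier (total_homology R X)"
  then show "total_homology_map Y f z = total_homology_map Y g z"
    unfolding total_homology_map_def
    using rhomology_map_homotopic [OF _ assms] by (auto simp: carrier_total_homology)
qed

text \<open>
  Functoriality: \<open>(g \<circ> s)\<^sub>* = g\<^sub>* \<circ> s\<^sub>*\<close>, and the image of a composition lies in the image of its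
  outer map.  This is the only source of monotonicity.
\<close>

lemma homology_image_compose_subset:
  assumes s: "continuous_map W X s" and g: "continuous_map X Y g"
  shows "homology_image R W Y (g \<circ> s) \<subseteq> homology_image R X Y g"
proof -
  have "total_homology_map Y (g \<circ> s) z = total_homology_map Y g (total_homology_map X s z)"
    if "z \<in> carrier (total_homology R W)" for z
    using that rhomology_map_compose [OF _ s g] by (auto simp: total_homology_map_def carrier_total_homology)
  then show ?thesis
    using hom_in_carrier [OF total_homology_map_hom [OF s]] unfolding homology_image_def by force
qed

section \<open>The image maps\<close>

lemma the_elem_image_constant:
  assumes "x \<in> A" "\<And>y. y \<in> A \<Longrightarrow> h y = h x"
  shows "the_elem (h ` A) = h x"
proof -
  have "h ` A = {h x}"
    using assms by blast
  then show ?thesis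
    by simp
qed

lemma Im_H_homotopy_class:
  assumes "continuous_map X Y f"
  shows "Im_H R X Y (homotopy_class X Y f) = homology_image R X Y f"
  unfolding Im_H_def
proof (rule the_elem_image_constant)
  show "f \<in> homotopy_class X Y f"
    using assms by (simp add: homotopy_class_def homotopy_rel_def)
  show "homology_image R X Y g = homology_image R X Y f" if "g \<in> homotopy_class X Y f" for g
    using that homology_image_homotopic [of X Y f g R] by (simp add: homotopy_class_def homotopy_rel_def)
qed

lemma Im_H_mono:
  assumes "F \<in> homotopy_classes X Y" "G \<in> homotopy_classes X Y" "leR X Y F G"
  shows "Im_H R X Y F \<subseteq> Im_H R X Y G"
proof -
  obtain f g where f: "continuous_map X Y f" "F = homotopy_class X Y f"
    and g: "continuous_map X Y g" "G = homotopy_class X Y g"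
    using assms by (meson homotopy_classesE)
  then obtain s where s: "continuous_map X X s" "homotopic_with (\<lambda>_. True) X Y f (g \<circ> s)"
    using assms(3) by (auto simp: leR_homotopy_class)
  have "homology_image R X Y f = homology_image R X Y (g \<circ> s)"
    using s(2) by (rule homology_image_homotopic)
  also have "\<dots> \<subseteq> homology_image R X Y g"
    using s(1) g(1) by (rule homology_image_compose_subset)
  finally show ?thesis
    using f g by (simp add: Im_H_homotopy_class)
qed

text \<open>
  Monotonicity applied in both directions: equivalent classes have images contained in each other.
\<close>

lemma Im_H_simR: "(F, G) \<in> simR X Y \<Longrightarrow> Im_H R X Y F = Im_H R X Y G"
  by (intro subset_antisym Im_H_mono) (auto simp: simR_def)

lemma Im_H'_piR:
  assumes "F \<in> homotopy_classes X Y"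
  shows "Im_H' R X Y (piR X Y F) = Im_H R X Y F"
  unfolding Im_H'_def
proof (rule the_elem_image_constant)
  show "F \<in> piR X Y F"
    unfolding piR_def using assms by (rule equiv_class_self [OF equiv_simR])
  show "Im_H R X Y G = Im_H R X Y F" if "G \<in> piR X Y F" for G
    using that Im_H_simR [of F G X Y R] by (simp add: piR_def)
qed

lemma R_classesE:
  assumes "A \<in> R_classes X Y"
  obtains F where "F \<in> homotopy_classes X Y" "A = piR X Y F"
  using assms by (auto simp: R_classes_def piR_def elim: quotientE)

theorem lemma4p2:
  fixes X :: "'a topology" and Y :: "'b topology" and R :: "'r::ring itself"
  shows
    "(homology_image R X Y respects homotopy_rel X Y
      \<and> (\<forall>f. continuous_map X Y f \<longrightarrow>
            Im_H R X Y (homotopy_class X Y f) = homology_image R X Y f)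
      \<and> Im_H R X Y \<in> homotopy_classes X Y \<rightarrow> Sub (total_homology R Y)
      \<and> monotone_on (homotopy_classes X Y) (leR X Y) (\<subseteq>) (Im_H R X Y))
   \<and> (Im_H R X Y respects simR X Y
      \<and> (\<forall>F \<in> homotopy_classes X Y. Im_H' R X Y (piR X Y F) = Im_H R X Y F)
      \<and> Im_H' R X Y \<in> R_classes X Y \<rightarrow> Sub (total_homology R Y)
      \<and> monotone_on (R_classes X Y) (leR' X Y) (\<subseteq>) (Im_H' R X Y))
   \<and> (\<forall>F \<in> homotopy_classes X Y. (Im_H' R X Y \<circ> piR X Y) F = Im_H R X Y F)"
proof -
  have "homology_image R X Y respects homotopy_rel X Y"
    unfolding congruent_def homotopy_rel_def using homology_image_homotopic [of X Y _ _ R] by blast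
  moreover have Im_H_Sub: "Im_H R X Y \<in> homotopy_classes X Y \<rightarrow> Sub (total_homology R Y)"
    by (auto elim!: homotopy_classesE simp: Im_H_homotopy_class Sub_def subgroup_homology_image)
  moreover have "monotone_on (homotopy_classes X Y) (leR X Y) (\<subseteq>) (Im_H R X Y)"
    by (rule monotone_onI) (rule Im_H_mono)
  moreover have "Im_H R X Y respects simR X Y"
    unfolding congruent_def using Im_H_simR [of _ _ X Y R] by blast
  moreover have "Im_H' R X Y \<in> R_classes X Y \<rightarrow> Sub (total_homology R Y)"
    using Im_H_Sub by (auto elim!: R_classesE simp: Im_H'_piR)
  moreover have "monotone_on (R_classes X Y) (leR' X Y) (\<subseteq>) (Im_H' R X Y)"
    by (rule monotone_onI) (auto elim!: R_classesE simp: Im_H'_piR leR'_piR dest: Im_H_mono [THEN subsetD, rotated 3])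
  ultimately show ?thesis
    by (simp add: Im_H_homotopy_class Im_H'_piR)
qed

end
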